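(* Let $p>2$ be a prime and let $x_1,x_2,x_3\in\mathbb F_p$. Let $\Gamma(x_1,x_2,x_3)$ be the projective closure of the affine curve $y^2=(t-x_1)(t-x_2)(t-x_3)$ over $\mathbb F_p$. Let $\left(c^{p-1}_1(x_1,x_2,x_3),c^{p-1}_2(x_1,x_2,x_3),c^{p-1}_3(x_1,x_2,x_3)\right)$ be the vector of polynomials defined in the context, which appears in a solution of the KZ equations. Then $$\int_{\Gamma(x_1,x_2,x_3)}\frac1{t-x_j}=-\,c_j^{p-1}(x_1,x_2,x_3),\qquad j=1,2,3.$$
   Context: For a rational function $h:\Gamma(x_1,x_2,x_3)\to\mathbb F_p$, the integral $\int_{\Gamma(x_1,x_2,x_3)}h$ is the sum $\sum h(P)\in\mathbb F_p$ over all points $P\in\Gamma(x_1,x_2,x_3)$ (over $\mathbb F_p$) at which $h(P)$ is defined; the points at which $h$ is not defined are omitted. Consider the expansion in powers of $t$ $$\prod_{s=1}^3(t-z_s)^{\frac{p-1}2}\Big(\frac1{t-z_1},\frac1{t-z_2},\frac1{t-z_3}\Big)=\sum_i\bar c^{\,i}(z_1,z_2,z_3)\,t^i,$$ where $\bar c^{\,i}=(\bar c^{\,i}_1,\bar c^{\,i}_2,\bar c^{\,i}_3)$ are vectors of polynomials in $z_1,z_2,z_3$ with integer coefficients. Let $c^i=(c^i_1,c^i_2,c^i_3)\in(\mathbb F_p[z_1,z_2,z_3])^3$ be the reduction of $\bar c^{\,i}$ modulo $p$; here $i$ is a superscript index, and $c^{p-1}_j$ is the $j$-th coordinate of $c^i$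 for $i=p-1$. The vector $I(z)=\prod_{1\le a<b\le3}(z_a-z_b)^{(p+1)^2/4}\,(c_1^{p-1}(z),c_2^{p-1}(z),c_3^{p-1}(z))$ is the solution referred to in the claim: it satisfies $I_1+I_2+I_3=0$ and the KZ equations over $\mathbb F_p$, $\frac{\partial I}{\partial z_i}=\frac12\sum_{j\ne i}\frac{\Omega_{i,j}}{z_i-z_j}I$, $i=1,2,3$, where $\Omega_{i,j}$ is the $3\times3$ matrix whose $(i,i)$ and $(j,j)$ entries are $-\frac12$, whose $(i,j)$ and $(j,i)$ entries are $1$, whose remaining diagonal entry is $\frac12$, and whose remaining off-diagonal entries are $0$.
   Formalization: For p = 3 the identity is stated only for those j for which x_j equals another x_k; otherwise it fails, e.g. p = 3, (x_1,x_2,x_3) = (0,1,2), j = 1, where the integral is 0 but the right-hand side is -1. *)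

theory Defs
  imports "Berlekamp_Zassenhaus.Finite_Field" "HOL-Computational_Algebra.Polynomial"
begin

text \<open>
  The prime field with \<open>p\<close> elements is \<open>'p mod_ring\<close> with \<open>'p :: prime_card\<close>, where \<open>p = CARD('p)\<close>.
  Polynomials in three variables over \<open>'a\<close> are iterated univariate polynomials; variable 1 is
  the outermost one and variable 3 the innermost one.
\<close>

type_synonym 'a poly3 = "'a poly poly poly"

definition const3 :: "'a::comm_ring_1 \<Rightarrow> 'a poly3" where
  "const3 a = [:[:[:a:]:]:]"

definition var3 :: "nat \<Rightarrow> 'a::comm_ring_1 poly3" where
  "var3 s = (if s = 1 then [:0, 1:] else if s = 2 then [:[:0, 1:]:] else [:[:[:0, 1:]:]:])"

definition eval3 :: "'a::comm_ring_1 poly3 \<Rightarrow> 'a \<Rightarrow> 'a \<Rightarrow> 'a \<Rightarrow> 'a" where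
  "eval3 F a b c = poly (poly (poly F [:[:a:]:]) [:b:]) c"

definition homogeneous3 :: "nat \<Rightarrow> 'a::comm_ring_1 poly3 \<Rightarrow> bool" where
  "homogeneous3 d F \<longleftrightarrow> (\<forall>a b c. coeff (coeff (coeff F a) b) c \<noteq> 0 \<longrightarrow> a + b + c = d)"


subsection \<open>The polynomials \<open>c\<close>\<close>

text \<open>
  The outermost variable of \<open>int poly3 poly\<close> is \<open>t\<close>. For \<open>p > 2\<close> the exponent \<open>(p - 1) div 2\<close> is
  positive, so the division by \<open>t - z\<^sub>j\<close> is exact.
\<close>

definition c_int :: "nat \<Rightarrow> nat \<Rightarrow> nat \<Rightarrow> int poly3" where
  "c_int p i j =
     coeff ((\<Prod>s\<in>{1..3}. [:- var3 s, 1:] ^ ((p - 1) div 2)) div [:- var3 j, 1:]) i"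

definition c_mod :: "nat \<Rightarrow> nat \<Rightarrow> 'p::prime_card mod_ring poly3" where
  "c_mod i j = map_poly (map_poly (map_poly of_int)) (c_int CARD('p) i j)"


subsection \<open>The projective curve\<close>

definition proj_point :: "'a::field \<Rightarrow> 'a \<Rightarrow> 'a \<Rightarrow> ('a \<times> 'a \<times> 'a) set" where
  "proj_point T Y Z = {(k * T, k * Y, k * Z) | k. k \<noteq> 0}"

text \<open>
  The homogenization of \<open>y\<^sup>2 - (t - x\<^sub>1) (t - x\<^sub>2) (t - x\<^sub>3)\<close>, in the homogeneous coordinates
  \<open>T, Y, Z\<close> (variables 1, 2, 3) with \<open>t = T / Z\<close> and \<open>y = Y / Z\<close>.
\<close>

definition curve_form :: "(nat \<Rightarrow> 'a::field) \<Rightarrow> 'a poly3" where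
  "curve_form x = var3 2 ^ 2 * var3 3 - (\<Prod>s\<in>{1..3}. var3 1 - const3 (x s) * var3 3)"

definition curve :: "(nat \<Rightarrow> 'a::field) \<Rightarrow> ('a \<times> 'a \<times> 'a) set set" where
  "curve x = {proj_point T Y Z | T Y Z.
     (T, Y, Z) \<noteq> (0, 0, 0) \<and> eval3 (curve_form x) T Y Z = 0}"


subsection \<open>Rational functions on the curve and their integrals\<close>

text \<open>
  A rational function on the curve is represented by a pair \<open>(F, G)\<close> of homogeneous polynomials of
  the same degree, with \<open>G\<close> not divisible by the (irreducible) form of the curve. Two pairs
  \<open>(F, G)\<close> and \<open>(F', G')\<close> represent the same function if the form of the curve divides
  \<open>F G' - F' G\<close>. The function is defined at a point \<open>P\<close> of the curve if some representative has a
  denominator that does not vanish at \<open>P\<close>; this includes points where the given \<open>G\<close> itself vanishes.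
\<close>

definition has_value_at ::
  "(nat \<Rightarrow> 'a::field) \<Rightarrow> 'a poly3 \<times> 'a poly3 \<Rightarrow> ('a \<times> 'a \<times> 'a) set \<Rightarrow> 'a \<Rightarrow> bool" where
  "has_value_at x h P v \<longleftrightarrow>
     (\<exists>d F' G'. homogeneous3 d F' \<and> homogeneous3 d G' \<and>
        curve_form x dvd fst h * G' - F' * snd h \<and>
        (\<exists>(T, Y, Z)\<in>P. eval3 G' T Y Z \<noteq> 0 \<and> v = eval3 F' T Y Z / eval3 G' T Y Z))"

definition defined_at ::
  "(nat \<Rightarrow> 'a::field) \<Rightarrow> 'a poly3 \<times> 'a poly3 \<Rightarrow> ('a \<times> 'a \<times> 'a) set \<Rightarrow> bool" where
  "defined_at x h P \<longleftrightarrow> (\<exists>v. has_value_at x h P v)"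

definition value_at ::
  "(nat \<Rightarrow> 'a::field) \<Rightarrow> 'a poly3 \<times> 'a poly3 \<Rightarrow> ('a \<times> 'a \<times> 'a) set \<Rightarrow> 'a" where
  "value_at x h P = (THE v. has_value_at x h P v)"

definition curve_integral ::
  "(nat \<Rightarrow> 'a::{field, finite}) \<Rightarrow> 'a poly3 \<times> 'a poly3 \<Rightarrow> 'a" where
  "curve_integral x h = (\<Sum>P\<in>{P \<in> curve x. defined_at x h P}. value_at x h P)"

text \<open>The function \<open>1 / (t - a)\<close>, which is \<open>Z / (T - a Z)\<close> in homogeneous coordinates.\<close>

definition inv_t_minus :: "'a::field \<Rightarrow> 'a poly3 \<times> 'a poly3" where
  "inv_t_minus a = (var3 3, var3 1 - const3 a * var3 3)"

end

theory Submission
  imports Defs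
begin

text \<open>
  Write \<open>f(t) = (t - x\<^sub>1) (t - x\<^sub>2) (t - x\<^sub>3)\<close>, \<open>a = x\<^sub>j\<close> and \<open>m = (p - 1) / 2\<close>.

  The function \<open>1 / (t - a)\<close> vanishes at the point at infinity and is undefined at the affine points
  with \<open>t = a\<close>, so the integral is the sum of \<open>1 / (t - a)\<close> over the affine points with \<open>t \<noteq> a\<close>
  (\<open>curve_integral_eq_affine_sum\<close>). Above a given \<open>t\<close> there lie as many points as \<open>f(t)\<close> has square
  roots, and modulo \<open>p\<close> this number is \<open>1 + f(t)\<^sup>m\<close> by Euler's criterion (\<open>card_square_roots\<close>). Since
  the inverses of the nonzero elements of the field sum to zero, what remains is the sum of
  \<open>f(t)\<^sup>m / (t - a)\<close> over \<open>t \<noteq> a\<close>.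

  This quotient is a polynomial \<open>P(t)\<close>, because \<open>m > 0\<close>. By hypothesis \<open>f\<^sup>m\<close> even has a double zero
  at \<open>a\<close>: for \<open>p > 3\<close> because \<open>m \<ge> 2\<close>, and for \<open>p = 3\<close> because \<open>a\<close> is a multiple zero of \<open>f\<close>. Hence
  \<open>P(a) = 0\<close>, and \<open>P\<close> may be summed over the whole field. The sum of \<open>t\<^sup>k\<close> over the field is \<open>-1\<close> if
  \<open>k\<close> is a positive multiple of \<open>p - 1\<close>, and \<open>0\<close> otherwise. As the degree of \<open>P\<close> is less than
  \<open>2 (p - 1)\<close>, only the coefficient of \<open>t\<close> to the power \<open>p - 1\<close> contributes
  (\<open>sum_poly_finite_field\<close>). Reduction modulo \<open>p\<close> and evaluation at \<open>x\<close> commute with the exact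
  division by \<open>t - z\<^sub>j\<close>, so this coefficient is the value of \<open>c\<^sub>j\<close> (\<open>eval3_c_mod\<close>).
\<close>

section \<open>Sums over a finite field\<close>

text \<open>
  The translation \<open>t \<mapsto> t + 1\<close> permutes the ring, yet it adds \<open>1\<close> to each of the summands of the sum
  of all elements.
\<close>

lemma of_nat_card_finite_ring: "of_nat CARD('a::{ring_1, finite}) = (0::'a)"
proof -
  have "(\<Sum>t\<in>(UNIV::'a set). t + 1) = (\<Sum>t\<in>(UNIV::'a set). t)"
    by (rule sum.reindex_bij_witness[of _ "\<lambda>t. t - 1" "\<lambda>t. t + 1"]) auto
  then show ?thesis by (simp add: sum.distrib)
qed

lemma power_card_minus_one:
  fixes t :: "'a::finite_field"
  assumes "t \<noteq> 0"
  shows "t ^ (CARD('a) - 1) = 1"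
proof -
  have "t * t ^ (CARD('a) - 1) = t * 1"
    using finite_field_power_card_eq_same[of t]
    by (simp flip: power_Suc)
  then show ?thesis using assms by simp
qed

lemma card_power_roots_le:
  fixes c :: "'a::idom"
  assumes "n > 0"
  shows "finite {t. t ^ n = c}" "card {t. t ^ n = c} \<le> n"
proof -
  let ?p = "monom 1 n - [:c:] :: 'a poly"
  have "coeff ?p n = 1" using assms by (cases n) auto
  then have nz: "?p \<noteq> 0" by (metis coeff_0 zero_neq_one)
  have roots: "{t. t ^ n = c} = {t. poly ?p t = 0}"
    by (auto simp: poly_monom)
  have "degree ?p \<le> n"
    by (intro degree_diff_le) (auto simp: degree_monom_le)
  then show "finite {t. t ^ n = c}" "card {t. t ^ n = c} \<le> n"
    using card_poly_roots_bound[OF nz] poly_roots_finite[OF nz] unfolding roots by auto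
qed

text \<open>
  If \<open>q - 1\<close> does not divide \<open>k\<close>, then some nonzero \<open>g\<close> has \<open>g\<^sup>k \<noteq> 1\<close>, and substituting \<open>g t\<close> for
  \<open>t\<close> multiplies the sum by \<open>g\<^sup>k\<close>; so the sum is zero. Otherwise, for \<open>k > 0\<close>, every nonzero \<open>t\<close>
  contributes \<open>1\<close> and \<open>t = 0\<close> contributes \<open>0\<close>. For \<open>k = 0\<close> the term at \<open>t = 0\<close> is \<open>1\<close> as well,
  and the sum is \<open>q = 0\<close>.
\<close>

lemma power_sum_finite_field:
  "(\<Sum>t\<in>(UNIV::'a::finite_field set). t ^ k) =
     (if k > 0 \<and> (CARD('a) - 1) dvd k then -1 else 0)"
proof -
  let ?q = "CARD('a)"
  have q: "?q > 1"
    using card_mono[of UNIV "{0, 1::'a}"] by simp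
  have card_nz: "card (UNIV - {0::'a}) = ?q - 1"
    by (simp add: card_Diff_subset)
  consider "k = 0" | "k > 0" "(?q - 1) dvd k" | "\<not> (?q - 1) dvd k" by auto
  then show ?thesis
  proof cases
    case 1
    then show ?thesis by (simp add: of_nat_card_finite_ring)
  next
    case 2
    have "(\<Sum>t\<in>(UNIV::'a set). t ^ k) = (\<Sum>t\<in>UNIV - {0::'a}. t ^ k)"
      using \<open>k > 0\<close> by (intro sum.mono_neutral_right) auto
    also have "\<dots> = (\<Sum>t\<in>UNIV - {0::'a}. 1)"
    proof (intro sum.cong refl)
      fix t :: 'a assume "t \<in> UNIV - {0}"
      then show "t ^ k = 1"
        using 2(2) power_card_minus_one[of t] by (auto elim!: dvdE simp: power_mult)
    qed
    also have "\<dots> = of_nat (?q - 1)" by (simp add: card_nz)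
    also have "\<dots> = -1"
      using q by (simp add: of_nat_diff of_nat_card_finite_ring)
    finally show ?thesis using 2 by simp
  next
    case 3
    \<comment> \<open>The equation \<open>t\<^sup>r = 1\<close> has at most \<open>r < q - 1\<close> solutions, so a suitable \<open>g\<close> exists.\<close>
    define r where "r = k mod (?q - 1)"
    have r: "0 < r" "r < ?q - 1"
      using 3 q by (auto simp: r_def mod_greater_zero_iff_not_dvd)
    have "\<not> UNIV - {0} \<subseteq> {t::'a. t ^ r = 1}"
    proof
      assume "UNIV - {0} \<subseteq> {t::'a. t ^ r = 1}"
      then have "?q - 1 \<le> card {t::'a. t ^ r = 1}"
        unfolding card_nz[symmetric] by (intro card_mono) auto
      then show False using card_power_roots_le(2)[OF r(1), of "1::'a"] r(2) by linarith
    qed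
    then obtain g :: 'a where g: "g \<noteq> 0" "g ^ r \<noteq> 1" by auto
    have "g ^ k = g ^ ((?q - 1) * (k div (?q - 1)) + r)" by (simp add: r_def)
    also have "\<dots> = g ^ r"
      by (simp only: power_add power_mult power_card_minus_one[OF g(1)] power_one mult_1_left)
    finally have gk: "g ^ k \<noteq> 1" using g(2) by simp
    have "(\<Sum>t\<in>(UNIV::'a set). t ^ k) = (\<Sum>t\<in>UNIV. (g * t) ^ k)"
      using g(1) by (intro sum.reindex_bij_witness[of _ "\<lambda>t. g * t" "\<lambda>t. t / g"]) auto
    also have "\<dots> = g ^ k * (\<Sum>t\<in>UNIV. t ^ k)"
      by (simp add: power_mult_distrib sum_distrib_left)
    finally have "(\<Sum>t\<in>(UNIV::'a set). t ^ k) = 0" using gk by auto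
    then show ?thesis using 3 by simp
  qed
qed

lemma sum_poly_finite_field:
  fixes P :: "'a::finite_field poly"
  assumes "degree P < 2 * (CARD('a) - 1)"
  shows "(\<Sum>t\<in>UNIV. poly P t) = - coeff P (CARD('a) - 1)"
proof -
  let ?n = "CARD('a) - 1"
  have "(\<Sum>t\<in>UNIV. poly P t) = (\<Sum>t\<in>UNIV. \<Sum>i\<le>degree P. coeff P i * t ^ i)"
    by (simp add: poly_altdef)
  also have "\<dots> = (\<Sum>i\<le>degree P. coeff P i * (\<Sum>t\<in>(UNIV::'a set). t ^ i))"
    by (subst sum.swap) (simp add: sum_distrib_left)
  also have "\<dots> = (\<Sum>i\<le>degree P. if i = ?n then - coeff P i else 0)"
  proof (intro sum.cong refl)
    fix i assume "i \<in> {..degree P}"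
    then have less: "i < 2 * ?n" using assms by simp
    have "(i > 0 \<and> ?n dvd i) \<longleftrightarrow> i = ?n"
    proof
      assume *: "i > 0 \<and> ?n dvd i"
      then obtain c where c: "i = ?n * c" by (elim conjE dvdE)
      with less * have "0 < c" "c < 2" by (auto simp: mult.commute)
      then have "c = 1" by simp
      then show "i = ?n" using c by simp
    qed (use less in auto)
    then show "coeff P i * (\<Sum>t\<in>(UNIV::'a set). t ^ i) = (if i = ?n then - coeff P i else 0)"
      by (simp add: power_sum_finite_field)
  qed
  also have "\<dots> = - coeff P ?n"
    by (auto simp: sum.delta coeff_eq_0)
  finally show ?thesis .
qed

text \<open>
  Inversion permutes the nonzero elements, so this is a power sum with exponent \<open>1\<close>; that
  exponent is a multiple of \<open>q - 1\<close> only if \<open>q = 2\<close>.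
\<close>

lemma sum_inverse_finite_field:
  assumes "CARD('a::finite_field) > 2"
  shows "(\<Sum>t\<in>UNIV - {a::'a}. 1 / (t - a)) = 0"
proof -
  have "(\<Sum>t\<in>UNIV - {a}. 1 / (t - a)) = (\<Sum>u\<in>UNIV - {0::'a}. u)"
    by (rule sum.reindex_bij_witness[of _ "\<lambda>u. a + 1 / u" "\<lambda>t. 1 / (t - a)"]) auto
  also have "\<dots> = (\<Sum>u\<in>(UNIV::'a set). u ^ 1)"
    by (simp add: sum.remove[of _ 0])
  also have "\<dots> = 0"
    using assms by (subst power_sum_finite_field) auto
  finally show ?thesis .
qed

text \<open>
  This is Euler's criterion. Squaring is two-to-one on the nonzero elements, so there are \<open>(q - 1) / 2\<close>
  nonzero squares. All of them are roots of \<open>t^((q - 1) / 2) - 1\<close>, which has no room for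
  further roots; on the nonsquares the power therefore takes the other square root of \<open>1\<close>, which is
  \<open>-1\<close>.
\<close>

lemma card_square_roots:
  fixes c :: "'a::finite_field"
  assumes odd: "odd CARD('a)"
  shows "of_nat (card {y. y\<^sup>2 = c}) = 1 + c ^ ((CARD('a) - 1) div 2)"
proof -
  let ?m = "(CARD('a) - 1) div 2"
  let ?S = "{y::'a. y \<noteq> 0}"
  have two_m: "2 * ?m = CARD('a) - 1" using odd by simp
  have "CARD('a) > 1" using card_mono[of UNIV "{0, 1::'a}"] by simp
  with two_m have m: "?m > 0" by linarith
  have two: "(2::'a) \<noteq> 0"
  proof
    assume "(2::'a) = 0"
    obtain l where "CARD('a) = 2 * l + 1" using odd by (auto elim: oddE)
    then have "of_nat CARD('a) = (2 * of_nat l + 1 :: 'a)" by simp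
    then show False using \<open>2 = 0\<close> by (simp add: of_nat_card_finite_ring)
  qed
  have neg: "- y \<noteq> y" if "y \<noteq> 0" for y :: 'a
  proof
    assume "- y = y"
    then have "y + y = 0" by (metis add.left_inverse)
    then have "2 * y = 0" by (simp only: mult_2)
    then show False using two that by simp
  qed
  have roots: "{y. y\<^sup>2 = z\<^sup>2} = {z, - z}" for z :: 'a
    by (auto simp: power2_eq_iff)
  have card_roots: "card {y. y\<^sup>2 = z\<^sup>2} = 2" if "z \<noteq> 0" for z :: 'a
    using neg[OF that] unfolding roots by auto
  have pow_m: "(z\<^sup>2) ^ ?m = 1" if "z \<noteq> 0" for z :: 'a
    by (simp only: power_mult[symmetric] two_m power_card_minus_one[OF that])
  have squares: "c \<in> (\<lambda>y. y\<^sup>2) ` ?S" if "c ^ ?m = 1"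
  proof -
    have sub: "(\<lambda>y. y\<^sup>2) ` ?S \<subseteq> {t::'a. t ^ ?m = 1}" using pow_m by auto
    have "card ?S = CARD('a) - 1"
      by (simp add: card_Diff_subset Collect_neg_eq Compl_eq_Diff_UNIV)
    then have "2 * ?m = card ?S" by (simp only: two_m)
    also have "\<dots> = (\<Sum>z\<in>(\<lambda>y. y\<^sup>2) ` ?S. card {y \<in> ?S. y\<^sup>2 = z})"
      using sum.image_gen[of ?S "\<lambda>_. 1::nat" "\<lambda>y. y\<^sup>2"] by simp
    also have "\<dots> = (\<Sum>z\<in>(\<lambda>y. y\<^sup>2) ` ?S. 2)"
    proof (intro sum.cong refl)
      fix w :: 'a assume "w \<in> (\<lambda>y. y\<^sup>2) ` ?S"
      then obtain z where z: "z \<noteq> 0" "w = z\<^sup>2" by auto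
      have "{y \<in> ?S. y\<^sup>2 = w} = {y. y\<^sup>2 = z\<^sup>2}" using z by auto
      then show "card {y \<in> ?S. y\<^sup>2 = w} = 2" using card_roots[OF z(1)] by simp
    qed
    finally have "card ((\<lambda>y::'a. y\<^sup>2) ` ?S) = ?m" by simp
    then have "(\<lambda>y. y\<^sup>2) ` ?S = {t::'a. t ^ ?m = 1}"
      using card_power_roots_le[OF m, of "1::'a"] by (intro card_seteq sub) auto
    then show ?thesis using that by auto
  qed
  show ?thesis
  proof (cases "\<exists>z. c = z\<^sup>2")
    case True
    then obtain z where c: "c = z\<^sup>2" by blast
    show ?thesis
    proof (cases "z = 0")
      case True
      then show ?thesis using c m by (simp add: zero_power)
    next
      case False
      then show ?thesis using card_roots[OF False] pow_m[OF False] c by simp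
    qed
  next
    case False
    then have none: "{y. y\<^sup>2 = c} = {}" and "c \<noteq> 0" by auto
    have "(c ^ ?m)\<^sup>2 = 1"
      by (simp only: power_mult[symmetric] mult.commute[of ?m] two_m power_card_minus_one[OF \<open>c \<noteq> 0\<close>])
    moreover have "c ^ ?m \<noteq> 1" using squares False by auto
    ultimately have "c ^ ?m = -1" by (simp add: power2_eq_1_iff)
    then show ?thesis by (simp only: none) simp
  qed
qed

section \<open>Polynomials in three variables\<close>

lemma eval3_add: "eval3 (F + G) a b c = eval3 F a b c + eval3 G a b c"
  and eval3_diff: "eval3 (F - G) a b c = eval3 F a b c - eval3 G a b c"
  and eval3_mult: "eval3 (F * G) a b c = eval3 F a b c * eval3 G a b c"
  and eval3_power: "eval3 (F ^ n) a b c = eval3 F a b c ^ n"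
  and eval3_one: "eval3 1 a b c = 1"
  and eval3_zero: "eval3 0 a b c = 0"
  and eval3_const3: "eval3 (const3 u) a b c = u"
  and eval3_var3: "eval3 (var3 1) a b c = a" "eval3 (var3 (Suc 0)) a b c = a"
    "eval3 (var3 2) a b c = b" "eval3 (var3 3) a b c = c"
  by (simp_all add: eval3_def const3_def var3_def)

lemmas eval3_simps = eval3_add eval3_diff eval3_mult eval3_power eval3_one eval3_zero eval3_const3 eval3_var3

lemma atLeastAtMost_one_three: "{Suc 0..3} = {1, 2, 3}"
  by auto

lemma eval3_curve_form:
  "eval3 (curve_form x) T Y Z = Y\<^sup>2 * Z - (\<Prod>s\<in>{1..3}. T - x s * Z)"
  by (simp add: curve_form_def atLeastAtMost_one_three eval3_simps)

lemma homogeneous3_diff: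
  assumes "homogeneous3 d F" "homogeneous3 d G"
  shows "homogeneous3 d (F - G)"
  using assms unfolding homogeneous3_def by (metis coeff_diff diff_zero)

lemma homogeneous3_mult:
  assumes F: "homogeneous3 d F" and G: "homogeneous3 e G"
  shows "homogeneous3 (d + e) (F * G)"
  unfolding homogeneous3_def
proof (intro allI impI)
  fix a b c
  assume "coeff (coeff (coeff (F * G) a) b) c \<noteq> 0"
  then have "(\<Sum>i\<le>a. \<Sum>j\<le>b. \<Sum>k\<le>c. coeff (coeff (coeff F i) j) k *
      coeff (coeff (coeff G (a - i)) (b - j)) (c - k)) \<noteq> 0"
    by (simp add: coeff_mult coeff_sum)
  then obtain i j k where "i \<le> a" "j \<le> b" "k \<le> c"
    and "coeff (coeff (coeff F i) j) k * coeff (coeff (coeff G (a - i)) (b - j)) (c - k) \<noteq> 0"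
    by (metis (no_types, lifting) atMost_iff sum.not_neutral_contains_not_neutral)
  moreover from this have "i + j + k = d" "(a - i) + (b - j) + (c - k) = e"
    using F G unfolding homogeneous3_def by (metis mult_zero_left mult_zero_right)+
  ultimately show "a + b + c = d + e" by linarith
qed

lemma homogeneous3_const3: "homogeneous3 0 (const3 a)"
  by (auto simp: homogeneous3_def const3_def coeff_pCons split: nat.splits)

lemma homogeneous3_var3: "homogeneous3 1 (var3 s)"
  by (auto simp: homogeneous3_def var3_def coeff_pCons one_pCons split: nat.splits if_splits)

lemma homogeneous3_linear: "homogeneous3 1 (var3 1 - const3 a * var3 3)"
  using homogeneous3_mult[OF homogeneous3_const3 homogeneous3_var3, of a 3]
  by (intro homogeneous3_diff homogeneous3_var3) simp

section \<open>The points of the curve\<close>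

definition affine_point :: "'a::field \<times> 'a \<Rightarrow> ('a \<times> 'a \<times> 'a) set" where
  "affine_point = (\<lambda>(t, y). proj_point t y 1)"

definition infinity_point :: "('a::field \<times> 'a \<times> 'a) set" where
  "infinity_point = proj_point 0 1 0"

lemma proj_point_scale:
  assumes "k \<noteq> 0"
  shows "proj_point (k * T) (k * Y) (k * Z) = proj_point T Y Z"
proof -
  have "\<exists>l'. l' \<noteq> 0 \<and> l = l' * k" if "l \<noteq> 0" for l
    using assms that by (intro exI[of _ "l / k"]) auto
  then show ?thesis
    unfolding proj_point_def using assms
    by (auto simp: mult.assoc) (metis mult.assoc mult_eq_0_iff)+
qed

lemma affine_point_inject:
  assumes "affine_point u = affine_point v"
  shows "u = v"
proof -
  obtain t y t' y' where uv: "u = (t, y)" "v = (t', y')" by (cases u, cases v)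
  have "(t, y, 1) \<in> affine_point u"
    by (auto simp: uv affine_point_def proj_point_def intro: exI[of _ 1])
  then have "(t, y, 1) \<in> proj_point t' y' 1"
    unfolding assms by (simp add: uv affine_point_def)
  then show ?thesis by (auto simp: uv proj_point_def)
qed

lemma infinity_point_not_affine: "infinity_point \<noteq> affine_point u"
proof
  assume *: "infinity_point = affine_point u"
  have "(0, 1, 0) \<in> (infinity_point :: ('a \<times> 'a \<times> 'a) set)"
    by (auto simp: infinity_point_def proj_point_def)
  then show False unfolding * by (cases u) (auto simp: affine_point_def proj_point_def)
qed

text \<open>
  On the line \<open>Z = 0\<close> the equation of the curve reads \<open>T\<^sup>3 = 0\<close>, which leaves a single point.
\<close>

lemma curve_eq:
  "curve x = insert infinity_point
     (affine_point ` {(t, y). y\<^sup>2 = (\<Prod>s\<in>{1..3}. t - x s)})" (is "_ = insert _ (_ ` ?A)")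
proof (intro equalityI subsetI)
  fix P assume "P \<in> curve x"
  then obtain T Y Z where P: "P = proj_point T Y Z" "(T, Y, Z) \<noteq> (0, 0, 0)"
    and eq: "Y\<^sup>2 * Z = (\<Prod>s\<in>{1..3}. T - x s * Z)"
    by (auto simp: curve_def eval3_curve_form)
  show "P \<in> insert infinity_point (affine_point ` ?A)"
  proof (cases "Z = 0")
    case True
    then have "T = 0" using eq by (simp add: atLeastAtMost_one_three)
    then have "P = infinity_point"
      using proj_point_scale[of Y 0 1 0] P True by (simp add: infinity_point_def)
    then show ?thesis by simp
  next
    case False
    have "(\<Prod>s\<in>{1..3}. T / Z - x s) = (\<Prod>s\<in>{1..3}. (T - x s * Z) / Z)"
      using False by (intro prod.cong) (simp_all add: diff_divide_distrib)
    also have "\<dots> = Y\<^sup>2 * Z / Z ^ 3"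
      by (simp only: prod_dividef eq) simp
    also have "\<dots> = (Y / Z)\<^sup>2"
      using False by (simp add: power_divide power2_eq_square power3_eq_cube)
    finally have "(T / Z, Y / Z) \<in> ?A" by simp
    moreover have "P = affine_point (T / Z, Y / Z)"
      using proj_point_scale[OF False, of "T / Z" "Y / Z" 1] False P by (simp add: affine_point_def)
    ultimately show ?thesis by blast
  qed
next
  fix P assume "P \<in> insert infinity_point (affine_point ` ?A)"
  then consider "P = proj_point 0 1 0"
    | t y where "P = proj_point t y 1" "y\<^sup>2 = (\<Prod>s\<in>{1..3}. t - x s)"
    by (auto simp: infinity_point_def affine_point_def)
  then show "P \<in> curve x"
  proof cases
    case 1
    have "eval3 (curve_form x) 0 1 0 = 0" by (simp add: eval3_curve_form atLeastAtMost_one_three)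
    then show ?thesis using 1 unfolding curve_def by fastforce
  next
    case 2
    then have "eval3 (curve_form x) t y 1 = 0" by (simp add: eval3_curve_form)
    then show ?thesis using 2 unfolding curve_def by fastforce
  qed
qed

section \<open>The values of the function on the curve\<close>

text \<open>
  If \<open>(F, G)\<close> represents the function, then \<open>Z G = F (T - a Z)\<close> holds at every point of the curve.
  Where \<open>Z \<noteq> 0\<close> this determines \<open>F / G\<close> when \<open>t \<noteq> a\<close>, and forces \<open>G = 0\<close> when \<open>t = a\<close>; the latter
  holds also when the point with \<open>t = a\<close> is singular.
\<close>

lemma has_value_at_affine_point:
  assumes curve: "y\<^sup>2 = (\<Prod>s\<in>{1..3}. t - x s)"
  shows "has_value_at x (inv_t_minus a) (affine_point (t, y)) v \<longleftrightarrow> t \<noteq> a \<and> v = 1 / (t - a)"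
proof
  assume "has_value_at x (inv_t_minus a) (affine_point (t, y)) v"
  then obtain F G k where dvd: "curve_form x dvd var3 3 * G - F * (var3 1 - const3 a * var3 3)"
    and k: "k \<noteq> 0" and G: "eval3 G (k * t) (k * y) k \<noteq> 0"
    and v: "v = eval3 F (k * t) (k * y) k / eval3 G (k * t) (k * y) k"
    by (auto simp: has_value_at_def affine_point_def proj_point_def inv_t_minus_def)
  have "eval3 (curve_form x) (k * t) (k * y) k = k ^ 3 * (y\<^sup>2 - (\<Prod>s\<in>{1..3}. t - x s))"
    by (simp add: eval3_curve_form atLeastAtMost_one_three power2_eq_square power3_eq_cube algebra_simps)
  then have "eval3 (curve_form x) (k * t) (k * y) k = 0" using curve by simp
  moreover obtain Q where "var3 3 * G - F * (var3 1 - const3 a * var3 3) = curve_form x * Q"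
    using dvd by (elim dvdE)
  then have "eval3 (var3 3 * G - F * (var3 1 - const3 a * var3 3)) (k * t) (k * y) k =
      eval3 (curve_form x * Q) (k * t) (k * y) k"
    by (simp only:)
  ultimately have "k * eval3 G (k * t) (k * y) k = eval3 F (k * t) (k * y) k * (k * t - a * k)"
    by (simp add: eval3_simps)
  then have "k * eval3 G (k * t) (k * y) k = k * (eval3 F (k * t) (k * y) k * (t - a))"
    by (simp only: algebra_simps)
  then have "eval3 G (k * t) (k * y) k = eval3 F (k * t) (k * y) k * (t - a)"
    using k by simp
  then show "t \<noteq> a \<and> v = 1 / (t - a)"
    using G v by auto
next
  assume *: "t \<noteq> a \<and> v = 1 / (t - a)"
  have "(t, y, 1) \<in> affine_point (t, y)"
    by (auto simp: affine_point_def proj_point_def intro: exI[of _ 1])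
  moreover have "eval3 (var3 1 - const3 a * var3 3) t y 1 = t - a" "eval3 (var3 3) t y 1 = 1"
    by (simp_all only: eval3_simps mult_1_right)
  ultimately show "has_value_at x (inv_t_minus a) (affine_point (t, y)) v"
    unfolding has_value_at_def using *
    by (intro exI[of _ 1] exI[of _ "var3 3"] exI[of _ "var3 1 - const3 a * var3 3"] conjI
        homogeneous3_var3 homogeneous3_linear bexI[of _ "(t, y, 1)"])
      (auto simp: inv_t_minus_def)
qed

text \<open>
  At infinity the equation \<open>Z G = F (T - a Z)\<close> only says \<open>0 = 0\<close>, so the value has to be found from
  the terms of first order: on the line \<open>Z = 0\<close> the equation of the curve vanishes to third order
  in \<open>T\<close>, so the congruence of \<open>Z G\<close> and \<open>F (T - a Z)\<close> gives \<open>F T = 0\<close> up to third order there,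
  and thus \<open>F = 0\<close> at \<open>T = 0\<close>. That the function is defined at infinity is seen from the
  representative \<open>(H, Y\<^sup>2)\<close>, where \<open>H\<close> is the product of the two factors \<open>T - x\<^sub>s Z\<close> with \<open>s \<noteq> j\<close>.
\<close>

lemma has_value_at_infinity_point:
  assumes j: "j \<in> {1, 2, 3::nat}"
  shows "has_value_at x (inv_t_minus (x j)) infinity_point v \<longleftrightarrow> v = 0"
proof
  assume "has_value_at x (inv_t_minus (x j)) infinity_point v"
  then obtain F G k where dvd: "curve_form x dvd var3 3 * G - F * (var3 1 - const3 (x j) * var3 3)"
    and v: "v = eval3 F 0 k 0 / eval3 G 0 k 0"
    by (auto simp: has_value_at_def infinity_point_def proj_point_def inv_t_minus_def)
  then obtain Q where Q: "var3 3 * G - F * (var3 1 - const3 (x j) * var3 3) = curve_form x * Q"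
    by (elim dvdE)
  \<comment> \<open>Compare the coefficients of \<open>T\<close> at \<open>Y = k\<close> and \<open>Z = 0\<close>.\<close>
  define e where "e q = poly (poly q [:k:]) 0" for q :: "'a poly poly"
  have e: "e (p * q) = e p * e q" "e (p - q) = e p - e q" "e (p + q) = e p + e q" for p q
    by (simp_all add: e_def)
  have "e (coeff (var3 3 * G - F * (var3 1 - const3 (x j) * var3 3)) 1) = - e (coeff F 0)"
    by (simp add: var3_def const3_def coeff_mult e coeff_pCons) (simp add: e_def)
  moreover have "e (coeff (curve_form x * Q) 1) = 0"
    by (simp add: curve_form_def atLeastAtMost_one_three var3_def const3_def coeff_mult e coeff_pCons)
       (simp add: e_def)
  moreover have "eval3 F 0 k 0 = e (coeff F 0)"
    by (simp add: eval3_def e_def poly_0_coeff_0)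
  ultimately show "v = 0" unfolding v Q by simp
next
  assume "v = 0"
  define H where "H = (\<Prod>s\<in>{1..3} - {j}. var3 1 - const3 (x s) * var3 3)"
  have "(var3 1 - const3 (x j) * var3 3) * H = (\<Prod>s\<in>{1..3}. var3 1 - const3 (x s) * var3 3)"
    unfolding H_def using j by (intro prod.remove[symmetric]) auto
  then have "curve_form x = var3 3 * var3 2 ^ 2 - H * (var3 1 - const3 (x j) * var3 3)"
    by (simp add: curve_form_def mult.commute)
  moreover obtain k l where "H = (var3 1 - const3 (x k) * var3 3) * (var3 1 - const3 (x l) * var3 3)"
  proof -
    have "card ({1..3} - {j}) = 2" using j by (subst card_Diff_singleton) auto
    then obtain k l where "k \<noteq> l" "{1..3} - {j} = {k, l}" by (auto simp only: card_2_iff)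
    then show ?thesis using that[of k l] by (simp add: H_def)
  qed
  moreover from this have "homogeneous3 2 H" "eval3 H 0 1 0 = 0"
    using homogeneous3_mult[OF homogeneous3_linear homogeneous3_linear, of "x k" "x l"]
    by (simp_all add: eval3_simps numeral_2_eq_2)
  moreover have "homogeneous3 2 (var3 2 ^ 2)"
    using homogeneous3_mult[OF homogeneous3_var3 homogeneous3_var3, of 2 2]
    by (simp add: power2_eq_square numeral_2_eq_2)
  moreover have "(0, 1, 0) \<in> (infinity_point :: ('a \<times> 'a \<times> 'a) set)"
    by (auto simp: infinity_point_def proj_point_def)
  ultimately show "has_value_at x (inv_t_minus (x j)) infinity_point v"
    unfolding has_value_at_def using \<open>v = 0\<close>
    by (intro exI[of _ 2] exI[of _ H] exI[of _ "var3 2 ^ 2"] conjI bexI[of _ "(0, 1, 0)"])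
      (auto simp: inv_t_minus_def eval3_simps)
qed

lemma curve_integral_eq_affine_sum:
  fixes x :: "nat \<Rightarrow> 'a::{field, finite}"
  assumes j: "j \<in> {1, 2, 3}"
  shows "curve_integral x (inv_t_minus (x j)) =
    (\<Sum>t\<in>UNIV - {x j}. of_nat (card {y. y\<^sup>2 = (\<Prod>s\<in>{1..3}. t - x s)}) / (t - x j))"
proof -
  let ?h = "inv_t_minus (x j)"
  define f where "f t = (\<Prod>s\<in>{1..3}. t - x s)" for t
  define A where "A = (SIGMA t:UNIV - {x j}. {y. y\<^sup>2 = f t})"
  have inf: "defined_at x ?h infinity_point" "value_at x ?h infinity_point = 0"
    using has_value_at_infinity_point[OF j, of x] by (simp_all add: defined_at_def value_at_def)
  have aff: "defined_at x ?h (affine_point (t, y)) \<longleftrightarrow> t \<noteq> x j"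
    "t \<noteq> x j \<Longrightarrow> value_at x ?h (affine_point (t, y)) = 1 / (t - x j)"
    if "y\<^sup>2 = f t" for t y
    using has_value_at_affine_point[OF that[unfolded f_def]] by (simp_all add: defined_at_def value_at_def)
  have domain: "{P \<in> curve x. defined_at x ?h P} = insert infinity_point (affine_point ` A)"
    unfolding curve_eq f_def[symmetric] A_def using inf(1) aff(1) by auto
  have "curve_integral x ?h = (\<Sum>P\<in>affine_point ` A. value_at x ?h P)"
    unfolding curve_integral_def domain using inf
    by (subst sum.insert) (auto simp: infinity_point_not_affine)
  also have "\<dots> = (\<Sum>u\<in>A. value_at x ?h (affine_point u))"
    by (subst sum.reindex) (auto intro: inj_onI affine_point_inject)
  also have "\<dots> = (\<Sum>(t, y)\<in>A. 1 / (t - x j))"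
    by (intro sum.cong refl) (auto simp: A_def intro!: aff(2))
  also have "\<dots> = (\<Sum>t\<in>UNIV - {x j}. \<Sum>y\<in>{y. y\<^sup>2 = f t}. 1 / (t - x j))"
    unfolding A_def by (subst sum.Sigma) auto
  finally show ?thesis by (simp add: f_def)
qed

section \<open>Reduction and evaluation of the coefficients\<close>

text \<open>
  Reduction modulo \<open>p\<close> followed by evaluation at \<open>x\<close> is a ring homomorphism \<open>\<phi>\<close>. Ring homomorphisms
  need not commute with \<open>div\<close>, but the division by the monic polynomial \<open>t - z\<^sub>j\<close> is exact here, so
  it suffices to apply \<open>\<phi>\<close> to the factorization.
\<close>

lemma eval3_c_mod:
  fixes x :: "nat \<Rightarrow> 'p::prime_card mod_ring"
  assumes j: "j \<in> {1, 2, 3}" and p: "CARD('p) > 2"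
  shows "eval3 (c_mod i j) (x 1) (x 2) (x 3) =
    coeff ((\<Prod>s\<in>{1..3}. [:- x s, 1:] ^ ((CARD('p) - 1) div 2)) div [:- x j, 1:]) i"
proof -
  let ?m = "(CARD('p) - 1) div 2"
  have m: "?m > 0" using p by simp
  define \<phi> :: "int poly3 \<Rightarrow> 'p mod_ring" where
    "\<phi> F = eval3 (map_poly (map_poly (map_poly of_int)) F) (x 1) (x 2) (x 3)" for F
  interpret two: map_poly_comm_ring_hom "map_poly (of_int :: int \<Rightarrow> 'p mod_ring)" ..
  interpret three: map_poly_comm_ring_hom "map_poly (map_poly (of_int :: int \<Rightarrow> 'p mod_ring))" ..
  interpret \<phi>: comm_ring_hom \<phi>
    by unfold_locales (simp_all add: \<phi>_def three.hom_add three.hom_mult eval3_simps)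
  interpret \<phi>P: map_poly_comm_ring_hom \<phi> ..
  have \<phi>_var: "\<phi> (var3 s) = x s" if "s \<in> {1, 2, 3}" for s
    using that by (auto simp: \<phi>_def var3_def eval3_def map_poly_pCons)
  have \<phi>_linear: "map_poly \<phi> [:- var3 s, 1:] = [:- x s, 1:]" if "s \<in> {1, 2, 3}" for s
    using \<phi>_var[OF that] by (simp add: map_poly_pCons \<phi>.hom_uminus)
  define M where "M = (\<Prod>s\<in>{1..3}. [:- var3 s, 1 :: int poly3:] ^ ?m)"
  have "[:- var3 j, 1:] dvd [:- var3 j, 1 :: int poly3:] ^ ?m"
    using m by (intro dvd_power) auto
  also have "\<dots> dvd M"
    unfolding M_def using j by (intro dvd_prodI) auto
  finally obtain R where R: "M = [:- var3 j, 1:] * R" by (elim dvdE)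
  have MR: "M div [:- var3 j, 1:] = R"
    by (subst R, rule nonzero_mult_div_cancel_left) simp
  have "map_poly \<phi> M = (\<Prod>s\<in>{1..3}. [:- x s, 1:] ^ ?m)"
    unfolding M_def \<phi>P.hom_prod \<phi>P.hom_power
    by (intro prod.cong refl) (subst \<phi>_linear, auto)
  moreover have "map_poly \<phi> M = [:- x j, 1:] * map_poly \<phi> R"
    by (simp only: R \<phi>P.hom_mult \<phi>_linear[OF j])
  ultimately have eq: "(\<Prod>s\<in>{1..3}. [:- x s, 1:] ^ ?m) = [:- x j, 1:] * map_poly \<phi> R"
    by (simp only:)
  have "(\<Prod>s\<in>{1..3}. [:- x s, 1:] ^ ?m) div [:- x j, 1:] = map_poly \<phi> R"
    by (subst eq, rule nonzero_mult_div_cancel_left) simp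
  moreover have "eval3 (c_mod i j) (x 1) (x 2) (x 3) = \<phi> (coeff R i)"
    by (simp only: c_mod_def c_int_def \<phi>_def MR[unfolded M_def])
  ultimately show ?thesis by (simp only: \<phi>.coeff_map_poly_hom)
qed

theorem theorem1p4:
  fixes x :: "nat \<Rightarrow> 'p::prime_card mod_ring" and j :: nat
  assumes "CARD('p) > 2"
    and "j \<in> {1, 2, 3}"
    and "CARD('p) = 3 \<Longrightarrow> \<exists>k\<in>{1, 2, 3}. k \<noteq> j \<and> x k = x j"
  shows "curve_integral x (inv_t_minus (x j)) =
           - eval3 (c_mod (CARD('p) - 1) j) (x 1) (x 2) (x 3)"
proof -
  let ?p = "CARD('p)" and ?a = "x j"
  define m where "m = (?p - 1) div 2"
  define f where "f t = (\<Prod>s\<in>{1..3}. t - x s)" for t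
  define M where "M = (\<Prod>s\<in>{1..3}. [:- x s, 1:] ^ m)"
  define P where "P = M div [:- ?a, 1:]"
  have odd: "odd CARD('p mod_ring)"
    using prime_odd_nat[OF prime_card] assms(1) by simp
  then have two_m: "2 * m = ?p - 1" and m: "m > 0"
    using assms(1) by (simp_all add: m_def)
  \<comment> \<open>The double zero makes \<open>P\<close> vanish at \<open>a\<close>, where the integral has no summand.\<close>
  have square: "[:- ?a, 1:] ^ 2 dvd M"
  proof (cases "?p = 3")
    case True
    then obtain k where k: "k \<in> {1, 2, 3}" "k \<noteq> j" "x k = ?a" using assms(3) by blast
    have "(\<Prod>s\<in>{j, k}. [:- x s, 1:] ^ m) dvd M"
      unfolding M_def using k assms(2) by (intro prod_dvd_prod_subset) auto
    moreover have "(\<Prod>s\<in>{j, k}. [:- x s, 1:] ^ m) = [:- ?a, 1:] ^ 2"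
      using k True by (simp add: m_def power2_eq_square)
    ultimately show ?thesis by simp
  next
    case False
    then have "2 \<le> m" using two_m assms(1) odd by (cases "m = 1") auto
    then have "[:- ?a, 1:] ^ 2 dvd [:- ?a, 1:] ^ m" by (rule le_imp_power_dvd)
    also have "\<dots> dvd M" unfolding M_def using assms(2) by (intro dvd_prodI) auto
    finally show ?thesis .
  qed
  then obtain R where R: "M = [:- ?a, 1:] * ([:- ?a, 1:] * R)"
    by (metis dvdE mult.assoc power2_eq_square)
  have P: "P = [:- ?a, 1:] * R"
    unfolding P_def by (subst R, rule nonzero_mult_div_cancel_left) simp
  have P_a: "poly P ?a = 0" by (simp add: P)
  have P_t: "poly P t = f t ^ m / (t - ?a)" if "t \<noteq> ?a" for t
  proof -
    have "f t ^ m = poly M t" by (simp add: M_def f_def poly_prod prod_power_distrib)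
    also have "\<dots> = (t - ?a) * poly P t" by (simp add: R P algebra_simps)
    finally show ?thesis using that by simp
  qed
  have "degree M = 3 * m"
    unfolding M_def by (subst degree_prod_eq_sum_degree) (auto simp: degree_power_eq)
  moreover have "degree P \<le> degree M"
  proof (rule dvd_imp_degree_le)
    show "P dvd M" by (simp only: R P dvd_triv_right)
    show "M \<noteq> 0" by (simp add: M_def)
  qed
  ultimately have degree: "degree P < 2 * (CARD('p mod_ring) - 1)"
    using two_m m by simp
  have "curve_integral x (inv_t_minus ?a) = (\<Sum>t\<in>UNIV - {?a}. (1 + f t ^ m) / (t - ?a))"
    using card_square_roots[OF odd]
    by (simp add: curve_integral_eq_affine_sum[OF assms(2)] f_def m_def)
  also have "\<dots> = (\<Sum>t\<in>UNIV - {?a}. 1 / (t - ?a)) + (\<Sum>t\<in>UNIV - {?a}. f t ^ m / (t - ?a))"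
    by (simp add: add_divide_distrib sum.distrib)
  also have "\<dots> = (\<Sum>t\<in>UNIV - {?a}. poly P t)"
    using assms(1) by (simp add: sum_inverse_finite_field P_t)
  also have "\<dots> = (\<Sum>t\<in>UNIV. poly P t)"
    using P_a by (simp add: sum.remove[of _ ?a])
  also have "\<dots> = - coeff P (?p - 1)"
    using sum_poly_finite_field[OF degree] by simp
  also have "\<dots> = - eval3 (c_mod (?p - 1) j) (x 1) (x 2) (x 3)"
    using eval3_c_mod[OF assms(2,1)] by (simp add: P_def M_def m_def)
  finally show ?thesis .
qed

end
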